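(* Let $H$ be a fixed graph that is not a linear forest all of whose components are paths of length at most $5$. Then any streaming algorithm for \textsc{Connectivity} in the AL model that uses $p$ passes over the stream must use $\Omega(n/p)$ bits of memory on $n$-vertex graphs $G$, even when $G$ is $H$-free.
   Context: Graphs are finite, simple, undirected. A linear forest is a disjoint union of paths; the length of a path is its number of edges. $G$ is $H$-free if it has no induced subgraph isomorphic to $H$. \textsc{Connectivity}: decide whether $G$ is connected. In the Adjacency List (AL) streaming model the graph arrives as a sequence of vertices in arbitrary fixed order, each together with the full list of its incident edges (each edge appears twice). A $p$-pass algorithm reads the sequence $p$ times with unlimited computation; memory is measured in bits. "Must use $\Omega(f)$ bits" means there is a constant $c>0$ such that every $p$-pass algorithm solving the problem correctly on all inputs of the stated class uses at least $c\cdot f$ bits on some $n$-vertex input, for all sufficiently large $n$ and all $p$. *)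

theory Defs
  imports Complex_Main "Graph_Theory.Digraph_Isomorphism"
begin

text \<open>
  A finite simple undirected graph is a \<^locale>\<open>pair_graph\<close>: an edge between \<open>u\<close> and \<open>v\<close> is
  represented by the two arcs \<open>(u, v)\<close> and \<open>(v, u)\<close>. For such graphs the strongly connected
  components are the connected components.
\<close>

definition path_graph :: "nat \<Rightarrow> nat pair_pre_digraph" where
  "path_graph l =
    \<lparr> pverts = {0..l}, parcs = {(i, j). i \<le> l \<and> j \<le> l \<and> (j = Suc i \<or> i = Suc j)} \<rparr>"

abbreviation components :: "'a pair_pre_digraph \<Rightarrow> ('a, 'a \<times> 'a) pre_digraph set" where
  "components G \<equiv> pre_digraph.sccs (with_proj G)"

definition linear_forest :: "'a pair_pre_digraph \<Rightarrow> bool" where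
  "linear_forest G \<longleftrightarrow>
    (\<forall>C \<in> components G. \<exists>l. digraph_iso C (with_proj (path_graph l)))"

definition free_of :: "'h pair_pre_digraph \<Rightarrow> 'a pair_pre_digraph \<Rightarrow> bool" where
  "free_of H G \<longleftrightarrow>
    \<not> (\<exists>F. induced_subgraph F (with_proj G) \<and> digraph_iso (with_proj H) F)"

definition free_graphs :: "'h pair_pre_digraph \<Rightarrow> nat \<Rightarrow> nat pair_pre_digraph set" where
  "free_graphs H n = {G. pair_graph G \<and> pverts G = {..<n} \<and> free_of H G}"

text \<open>
  One item of an adjacency list stream is a vertex with a list of its incident edges, in any order.
  The edge between \<open>u\<close> and \<open>v\<close> occurs as \<open>(u, v)\<close> in the item of \<open>u\<close> and as \<open>(v, u)\<close> in that of \<open>v\<close>.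
\<close>

type_synonym 'a al_item = "'a \<times> ('a \<times> 'a) list"

definition al_stream :: "'a pair_pre_digraph \<Rightarrow> 'a al_item list \<Rightarrow> bool" where
  "al_stream G s \<longleftrightarrow>
    distinct (map fst s) \<and> set (map fst s) = pverts G \<and>
    (\<forall>(v, es) \<in> set s. distinct es \<and> set es = out_arcs (with_proj G) v)"

text \<open>
  The state of an algorithm is the content of its memory, a bit string, initially empty. The
  operations are arbitrary functions, so computation is unlimited and deterministic. The first
  argument of \<open>start_pass\<close> and \<open>step\<close> is the number of the current pass, counted from 0: an
  algorithm need not spend memory on it. Likewise the work done within one item is not charged.
  Both conventions only enlarge the class of algorithms to which a lower bound applies.
\<close>

type_synonym memory = "bool list"

record streaming_alg =
  start_pass :: "nat \<Rightarrow> memory \<Rightarrow> memory"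
  step :: "nat \<Rightarrow> nat al_item \<Rightarrow> memory \<Rightarrow> memory"
  answer :: "memory \<Rightarrow> bool"

primrec after_passes :: "streaming_alg \<Rightarrow> nat al_item list \<Rightarrow> nat \<Rightarrow> memory" where
  "after_passes A s 0 = []"
| "after_passes A s (Suc i) = fold (step A i) s (start_pass A i (after_passes A s i))"

definition memory_at :: "streaming_alg \<Rightarrow> nat al_item list \<Rightarrow> nat \<Rightarrow> nat \<Rightarrow> memory" where
  "memory_at A s i k = fold (step A i) (take k s) (start_pass A i (after_passes A s i))"

text \<open>The maximum below is over a nonempty set whenever \<open>p \<ge> 1\<close>.\<close>

definition bits_used :: "streaming_alg \<Rightarrow> nat \<Rightarrow> nat al_item list \<Rightarrow> nat" where
  "bits_used A p s = Max {length (memory_at A s i k) | i k. i < p \<and> k \<le> length s}"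

definition solves_connectivity ::
  "streaming_alg \<Rightarrow> nat \<Rightarrow> nat pair_pre_digraph set \<Rightarrow> bool" where
  "solves_connectivity A p \<G> \<longleftrightarrow>
    (\<forall>G \<in> \<G>. \<forall>s. al_stream G s \<longrightarrow>
      (answer A (after_passes A s p) \<longleftrightarrow> Digraph_Component.connected (with_proj G)))"

end

theory Submission
  imports Defs
begin

text \<open>
  The proof reduces disjointness to connectivity. One player holds the lists of the even vertices and
  \<open>x\<close>, the other those of the odd vertices and \<open>y\<close>, and the vertices \<open>2 * i\<close>, \<open>2 * i + 1\<close> are adjacent.
  Each of them is joined to the rest of its player's side unless \<open>i\<close> lies in the player's set, so the
  graph is connected iff \<open>x \<inter> y = {}\<close>. The memory contents at the points where the stream changes
  hands form a transcript of \<open>2 * p\<close> messages, and the pairs of complementary sets are a fooling set.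

  If the live vertices of each side form a star, the graph has girth at least 6, which settles every
  \<open>H\<close> with a triangle or a 4-cycle. If they form a clique, an induced subgraph without triangles and
  4-cycles has maximum degree 2 and no non-backtracking walk with six edges, so its components are
  paths of length at most 5.
\<close>

section \<open>Two-player simulation of a streaming algorithm\<close>

text \<open>The exact count is \<open>2 ^ (S + 1) - 1\<close>. The cruder \<open>4 ^ S\<close> still
  agrees with it at \<open>S = 0\<close> and keeps the exponents below pure products.\<close>

lemma card_bool_lists_le: "card {m :: bool list. length m \<le> S} \<le> 4 ^ S"
proof (induction S)
  case 0
  then show ?case by simp
next
  case (Suc S)
  have fin: "finite {m :: bool list. length m \<le> S}"
    using finite_lists_length_le[of "UNIV :: bool set" S] by simp
  have sub: "{m :: bool list. length m \<le> Suc S} \<subseteq>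
      insert [] ((#) True ` {m. length m \<le> S} \<union> (#) False ` {m. length m \<le> S})"
  proof
    fix m :: "bool list"
    assume "m \<in> {m. length m \<le> Suc S}"
    then show "m \<in> insert [] ((#) True ` {m. length m \<le> S} \<union> (#) False ` {m. length m \<le> S})"
      by (cases m; cases "hd m") auto
  qed
  have "card {m :: bool list. length m \<le> Suc S} \<le>
      card (insert [] ((#) True ` {m. length m \<le> S} \<union> (#) False ` {m. length m \<le> S}))"
    by (rule card_mono[OF _ sub]) (use fin in auto)
  also have "\<dots> \<le> Suc (card ((#) True ` {m. length m \<le> S} \<union> (#) False ` {m. length m \<le> S}))"
    by (rule card_insert_le_m1) auto
  also have "\<dots> \<le> Suc (card ((#) True ` {m. length m \<le> S}) + card ((#) False ` {m. length m \<le> S}))"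
    by (simp add: card_Un_le)
  also have "\<dots> = Suc (2 * card {m :: bool list. length m \<le> S})"
    by (simp add: card_image)
  also have "\<dots> \<le> Suc (2 * 4 ^ S)"
    using Suc.IH by simp
  also have "\<dots> \<le> 4 ^ Suc S"
    using one_le_power[of "4::nat" S] by simp
  finally show ?case .
qed

lemma length_memory_at_le:
  assumes "i < p" "k \<le> length s"
  shows "length (memory_at A s i k) \<le> bits_used A p s"
proof -
  have "{length (memory_at A s i k) | i k. i < p \<and> k \<le> length s} =
      (\<lambda>(i, k). length (memory_at A s i k)) ` ({..<p} \<times> {..length s})"
    by auto
  then have "finite {length (memory_at A s i k) | i k. i < p \<and> k \<le> length s}"
    by simp
  then show ?thesis
    unfolding bits_used_def using assms by (intro Max_ge) auto
qed

lemma memory_at_length: "memory_at A s i (length s) = after_passes A s (Suc i)"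
  by (simp add: memory_at_def)

lemma memory_at_append:
  "memory_at A (s @ t) i (length s) = fold (step A i) s (start_pass A i (after_passes A (s @ t) i))"
  by (simp add: memory_at_def)

lemma after_passes_append:
  "after_passes A (s @ t) (Suc i) = fold (step A i) t (memory_at A (s @ t) i (length s))"
  by (simp add: memory_at_append)

text \<open>Cut and paste: by induction the mixed run on \<open>s @ t'\<close> enters each pass as
  \<open>s @ t\<close> does. After \<open>s\<close> it is in the common handover state, from which
  \<open>t'\<close> continues as in \<open>s' @ t'\<close> and ends the pass in the common final
  state.\<close>

lemma after_passes_cross:
  assumes "\<And>i. i < p \<Longrightarrow> memory_at A (s @ t) i (length s) = memory_at A (s' @ t') i (length s')"
    and "\<And>i. i < p \<Longrightarrow> after_passes A (s @ t) (Suc i) = after_passes A (s' @ t') (Suc i)"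
  shows "after_passes A (s @ t') p = after_passes A (s @ t) p"
  using assms
proof (induction p)
  case 0
  then show ?case by simp
next
  case (Suc p)
  have eq: "after_passes A (s @ t') p = after_passes A (s @ t) p"
    using Suc.prems by (intro Suc.IH) simp_all
  have "after_passes A (s @ t') (Suc p) = fold (step A p) t' (memory_at A (s @ t) p (length s))"
    unfolding after_passes_append memory_at_append eq ..
  also have "\<dots> = after_passes A (s' @ t') (Suc p)"
    unfolding after_passes_append Suc.prems(1)[OF lessI] ..
  also have "\<dots> = after_passes A (s @ t) (Suc p)"
    using Suc.prems(2)[OF lessI] by simp
  finally show ?case .
qed

text \<open>If two members had the same transcript, both crossed runs would end as accepting runs
  do, against \<open>reject\<close>. So the members inject into the transcripts, sequences of
  \<open>p\<close> pairs of memories of at most \<open>S\<close> bits.\<close>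

lemma fooling_set_bound:
  fixes f g :: "'i \<Rightarrow> nat al_item list"
  assumes fin: "finite I"
    and bound: "\<And>x. x \<in> I \<Longrightarrow> bits_used A p (f x @ g x) \<le> S"
    and accept: "\<And>x. x \<in> I \<Longrightarrow> answer A (after_passes A (f x @ g x) p)"
    and reject: "\<And>x x'. x \<in> I \<Longrightarrow> x' \<in> I \<Longrightarrow> x \<noteq> x' \<Longrightarrow>
      \<not> answer A (after_passes A (f x @ g x') p) \<or> \<not> answer A (after_passes A (f x' @ g x) p)"
  shows "card I \<le> 4 ^ (2 * S * p)"
proof -
  define L where "L = {m :: memory. length m \<le> S}"
  have finL: "finite L"
    using finite_lists_length_le[of "UNIV :: bool set" S] by (simp add: L_def)
  \<comment> \<open>The transcript: for each pass, the state handed to the second player and the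
    state handed back.\<close>
  define T where "T x = map (\<lambda>i. (memory_at A (f x @ g x) i (length (f x)),
    after_passes A (f x @ g x) (Suc i))) [0..<p]" for x
  have T_eqD: "memory_at A (f x @ g x) i (length (f x)) = memory_at A (f x' @ g x') i (length (f x'))"
      "after_passes A (f x @ g x) (Suc i) = after_passes A (f x' @ g x') (Suc i)"
    if "T x = T x'" "i < p" for x x' i
    using that map_eq_conv unfolding T_def by (auto simp del: after_passes.simps)
  have "inj_on T I"
  proof (rule inj_onI, rule ccontr)
    fix x x'
    assume *: "x \<in> I" "x' \<in> I" "T x = T x'" "x \<noteq> x'"
    have "after_passes A (f x @ g x') p = after_passes A (f x @ g x) p"
      using T_eqD[OF *(3)] by (rule after_passes_cross)
    moreover have "after_passes A (f x' @ g x) p = after_passes A (f x' @ g x') p"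
      using T_eqD[OF *(3)[symmetric]] by (rule after_passes_cross)
    ultimately show False
      using accept reject * by metis
  qed
  moreover have "T ` I \<subseteq> {ms. set ms \<subseteq> L \<times> L \<and> length ms = p}"
  proof -
    have "memory_at A (f x @ g x) i (length (f x)) \<in> L \<and> after_passes A (f x @ g x) (Suc i) \<in> L"
      if "x \<in> I" "i < p" for x i
      using length_memory_at_le[OF that(2), of "length (f x)" "f x @ g x" A]
        length_memory_at_le[OF that(2), of "length (f x @ g x)" "f x @ g x" A]
        bound[OF that(1)]
      unfolding memory_at_length L_def by simp
    then show ?thesis
      unfolding T_def by auto
  qed
  ultimately have "card I \<le> card {ms. set ms \<subseteq> L \<times> L \<and> length ms = p}"
    using finL by (intro card_inj_on_le[of T] finite_lists_length_eq) auto
  also have "\<dots> = (card L * card L) ^ p"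
    using finL by (simp add: card_lists_length_eq card_cartesian_product)
  also have "\<dots> \<le> (4 ^ S * 4 ^ S) ^ p"
    using card_bool_lists_le[of S] by (intro power_mono mult_mono) (auto simp: L_def)
  also have "\<dots> = 4 ^ (2 * S * p)"
    by (simp add: power_add[symmetric] power_mult[symmetric] mult_2)
  finally show ?thesis .
qed

section \<open>Hard instances\<close>

text \<open>
  The flag \<open>c\<close> selects the clique version. The star centres \<open>0\<close> and \<open>1\<close> are not matched: the path
  \<open>0, 2, 3, 1\<close> links the two sides, for which \<open>x\<close> and \<open>y\<close> have to avoid \<open>0\<close> and \<open>1\<close>. When \<open>n\<close> is odd,
  the last vertex has no partner.
\<close>

definition live :: "nat set \<Rightarrow> nat set \<Rightarrow> nat \<Rightarrow> bool" where
  "live x y u \<longleftrightarrow> u div 2 \<notin> (if even u then x else y)"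

definition matched :: "nat \<Rightarrow> nat \<Rightarrow> bool" where
  "matched u v \<longleftrightarrow> u \<noteq> v \<and> u div 2 = v div 2 \<and> 1 \<le> u div 2"

definition side_adj :: "bool \<Rightarrow> nat set \<Rightarrow> nat set \<Rightarrow> nat \<Rightarrow> nat \<Rightarrow> bool" where
  "side_adj c x y u v \<longleftrightarrow>
    u \<noteq> v \<and> even u = even v \<and> live x y u \<and> live x y v \<and> (c \<or> u div 2 = 0 \<or> v div 2 = 0)"

definition gadget_adj :: "bool \<Rightarrow> nat set \<Rightarrow> nat set \<Rightarrow> nat \<Rightarrow> nat \<Rightarrow> bool" where
  "gadget_adj c x y u v \<longleftrightarrow> matched u v \<or> side_adj c x y u v"

definition gadget :: "bool \<Rightarrow> nat \<Rightarrow> nat set \<Rightarrow> nat set \<Rightarrow> nat pair_pre_digraph" where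
  "gadget c n x y =
    \<lparr> pverts = {..<n}, parcs = {(u, v). u < n \<and> v < n \<and> gadget_adj c x y u v} \<rparr>"

definition half_stream :: "bool \<Rightarrow> nat \<Rightarrow> nat set \<Rightarrow> nat set \<Rightarrow> bool \<Rightarrow> nat al_item list" where
  "half_stream c n x y b =
    map (\<lambda>v. (v, map (Pair v) (filter (gadget_adj c x y v) [0..<n])))
      (filter (\<lambda>v. even v = b) [0..<n])"

lemma nat_eq_half_parity: "u div 2 = v div 2 \<Longrightarrow> even u = even v \<Longrightarrow> u = v" for u v :: nat
  by (metis mult_div_mod_eq odd_iff_mod_2_eq_one even_iff_mod_2_eq_zero)

lemma pverts_gadget [simp]: "pverts (gadget c n x y) = {..<n}"
  by (simp add: gadget_def)

lemma parcs_gadget: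
  "(u, v) \<in> parcs (gadget c n x y) \<longleftrightarrow> u < n \<and> v < n \<and> gadget_adj c x y u v"
  by (simp add: gadget_def)

lemma matched_sym: "matched u v \<Longrightarrow> matched v u"
  by (auto simp: matched_def)

lemma side_adj_sym: "side_adj c x y u v \<Longrightarrow> side_adj c x y v u"
  by (auto simp: side_adj_def)

lemma gadget_adj_sym: "gadget_adj c x y u v \<Longrightarrow> gadget_adj c x y v u"
  by (auto simp: gadget_adj_def intro: matched_sym side_adj_sym)

lemma gadget_adj_irrefl: "\<not> gadget_adj c x y u u"
  by (simp add: gadget_adj_def matched_def side_adj_def)

lemma matched_parity: "matched u v \<Longrightarrow> even u \<noteq> even v"
  using nat_eq_half_parity[of u v] by (auto simp: matched_def)

lemma matched_unique: "matched u v \<Longrightarrow> matched u w \<Longrightarrow> v = w"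
  by (metis matched_def matched_parity nat_eq_half_parity)

lemma pair_graph_gadget: "pair_graph (gadget c n x y)"
proof
  have sub: "parcs (gadget c n x y) \<subseteq> {..<n} \<times> {..<n}"
    by (auto simp: gadget_def)
  then show "finite (parcs (gadget c n x y))"
    by (rule finite_subset) simp
  show "finite (pverts (gadget c n x y))"
    by simp
  fix e
  assume e: "e \<in> parcs (gadget c n x y)"
  with sub show "fst e \<in> pverts (gadget c n x y)" "snd e \<in> pverts (gadget c n x y)"
    by auto
  show "fst e \<noteq> snd e"
    using e gadget_adj_irrefl parcs_gadget by (metis prod.collapse)
next
  show "symmetric (with_proj (gadget c n x y))"
    unfolding symmetric_def with_proj_simps
    by (rule symI) (simp add: parcs_gadget gadget_adj_sym)
qed

lemma al_stream_gadget:
  "al_stream (gadget c n x y) (half_stream c n x y True @ half_stream c n x y False)"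
proof -
  have "map fst (half_stream c n x y b) = filter (\<lambda>v. even v = b) [0..<n]" for b
    by (simp add: half_stream_def comp_def)
  moreover have "distinct es \<and> set es = out_arcs (with_proj (gadget c n x y)) v"
    if "(v, es) \<in> set (half_stream c n x y b)" for v es b
    using that by (auto simp: half_stream_def out_arcs_def parcs_gadget distinct_map inj_on_def)
  ultimately show ?thesis
    unfolding al_stream_def by auto
qed

text \<open>The first player can write its half without knowing \<open>y\<close>: partner edges do
  not depend on the sets, and a side edge at an even vertex has two even ends, whose liveness is
  decided by \<open>x\<close>.\<close>

lemma half_stream_True: "half_stream c n x y True = half_stream c n x {} True"
proof -
  have "gadget_adj c x y v = gadget_adj c x {} v" if "even v" for v
    using that by (auto simp: gadget_adj_def side_adj_def live_def fun_eq_iff)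
  then show ?thesis
    by (auto simp: half_stream_def)
qed

lemma half_stream_False: "half_stream c n x y False = half_stream c n {} y False"
proof -
  have "gadget_adj c x y v = gadget_adj c {} y v" if "odd v" for v
    using that by (auto simp: gadget_adj_def side_adj_def live_def fun_eq_iff)
  then show ?thesis
    by (auto simp: half_stream_def)
qed

section \<open>Connectivity of the gadgets and disjointness\<close>

lemma (in pair_sym_digraph) connected_iff_reachable:
  "Digraph_Component.connected (with_proj G) \<longleftrightarrow>
    pverts G \<noteq> {} \<and> (\<forall>u \<in> pverts G. \<forall>v \<in> pverts G. u \<rightarrow>\<^sup>*\<^bsub>with_proj G\<^esub> v)"
  unfolding connected_def strongly_connected_def reachable_mk_symmetric_eq[OF pair_sym_arcs]
  by simp

lemma connected_gadget_iff:
  assumes n: "4 \<le> n" and x: "x \<subseteq> {2..<n div 2}" and y: "y \<subseteq> {2..<n div 2}"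
  shows "Digraph_Component.connected (with_proj (gadget c n x y)) \<longleftrightarrow> x \<inter> y = {}"
proof -
  let ?G = "gadget c n x y"
  interpret pair_graph ?G by (rule pair_graph_gadget)
  have adj: "u \<rightarrow>\<^sup>*\<^bsub>with_proj ?G\<^esub> v" if "u < n" "v < n" "gadget_adj c x y u v" for u v
    using that by (intro reachable_adjI) (simp add: parcs_gadget)
  show ?thesis
  proof
    assume conn: "Digraph_Component.connected (with_proj ?G)"
    show "x \<inter> y = {}"
    proof (rule ccontr)
      assume "x \<inter> y \<noteq> {}"
      then obtain i where i: "i \<in> x" "i \<in> y" by auto
      with x have "2 \<le> i" "i < n div 2" by auto
      then have i2: "2 \<le> i" "2 * i < n" by linarith+
      have "(2 * i) \<rightarrow>\<^sup>*\<^bsub>with_proj ?G\<^esub> 0"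
        using conn i2 unfolding connected_iff_reachable by auto
      \<comment> \<open>Both \<open>2 * i\<close> and \<open>2 * i + 1\<close> are dead and have no
        neighbour but each other, so the value \<open>i\<close> of \<open>u div 2\<close> is
        invariant along the walk.\<close>
      then have "0 div 2 = i"
      proof (induction rule: reachable_induct)
        case base
        show ?case by simp
      next
        case (step u v)
        then have "gadget_adj c x y u v" by (simp add: parcs_gadget)
        moreover have "\<not> live x y u" using step.IH i by (simp add: live_def)
        ultimately show ?case
          using step.IH by (simp add: gadget_adj_def side_adj_def matched_def)
      qed
      with i2 show False by simp
    qed
  next
    assume disj: "x \<inter> y = {}"
    \<comment> \<open>This covers the centres, the pair \<open>2\<close>, \<open>3\<close> of the
      linking path and, for odd \<open>n\<close>, the last vertex.\<close>
    have small: "live x y u" if "u div 2 < 2 \<or> n div 2 \<le> u div 2" for u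
      using that x y by (auto simp: live_def subset_iff)
    have "3 \<rightarrow>\<^sup>*\<^bsub>with_proj ?G\<^esub> 1"
      using n small[of 3] small[of 1] by (intro adj) (auto simp: gadget_adj_def side_adj_def)
    moreover have "2 \<rightarrow>\<^sup>*\<^bsub>with_proj ?G\<^esub> 3"
      using n by (intro adj) (auto simp: gadget_adj_def matched_def)
    moreover have "0 \<rightarrow>\<^sup>*\<^bsub>with_proj ?G\<^esub> 2"
      using n small[of 0] small[of 2] by (intro adj) (auto simp: gadget_adj_def side_adj_def)
    ultimately have "0 \<rightarrow>\<^sup>*\<^bsub>with_proj ?G\<^esub> 1"
      by (meson reachable_trans)
    then have "1 \<rightarrow>\<^sup>*\<^bsub>with_proj ?G\<^esub> 0"
      by (rule symmetric_reachable')
    have live: "u \<rightarrow>\<^sup>*\<^bsub>with_proj ?G\<^esub> 0" if u: "u < n" "live x y u" for u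
    proof -
      define z where "z = (if even u then 0 else 1 :: nat)"
      have z: "z < n" "live x y z" "z div 2 = 0" "even z = even u"
        using n small[of z] by (auto simp: z_def)
      have "u \<rightarrow>\<^sup>*\<^bsub>with_proj ?G\<^esub> z"
      proof (cases "u = z")
        case False
        then show ?thesis using u z by (intro adj) (auto simp: gadget_adj_def side_adj_def)
      qed (use z in simp)
      moreover have "z \<rightarrow>\<^sup>*\<^bsub>with_proj ?G\<^esub> 0"
        using \<open>1 \<rightarrow>\<^sup>*\<^bsub>with_proj ?G\<^esub> 0\<close> n by (auto simp: z_def)
      ultimately show ?thesis by (rule reachable_trans)
    qed
    have to0: "u \<rightarrow>\<^sup>*\<^bsub>with_proj ?G\<^esub> 0" if u: "u < n" for u
    proof (cases "live x y u")
      case False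
      \<comment> \<open>A dead vertex escapes through its partner \<open>v\<close>, which is below
        \<open>n\<close> because \<open>u div 2 < n div 2\<close>, and live because \<open>x\<close>
        and \<open>y\<close> are disjoint.\<close>
      define v where "v = (if even u then Suc u else u - 1)"
      have half: "2 \<le> u div 2" "u div 2 < n div 2"
        using small[of u] False by (meson not_less)+
      have v: "v div 2 = u div 2" "even v \<noteq> even u" "v < n" "v \<noteq> u"
        using half unfolding v_def by (auto elim!: evenE oddE)
      have "live x y v"
        using False v disj by (auto simp: live_def split: if_splits)
      moreover have "u \<rightarrow>\<^sup>*\<^bsub>with_proj ?G\<^esub> v"
        using u v half by (intro adj) (auto simp: gadget_adj_def matched_def)
      ultimately show ?thesis
        using live v(3) by (meson reachable_trans)
    qed (use live u in simp)
    then show "Digraph_Component.connected (with_proj ?G)"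
      unfolding connected_iff_reachable
      using n by (auto simp: lessThan_empty_iff intro: reachable_trans symmetric_reachable')
  qed
qed

text \<open>The fooling set consists of the pairs \<open>(x, U - x)\<close> for subsets
  \<open>x\<close> of \<open>U\<close>. If \<open>x\<close> and \<open>x'\<close> differ, then
  \<open>x - x'\<close> or \<open>x' - x\<close> is nonempty, so one of the two crossed graphs is
  disconnected.\<close>

lemma gadget_lower_bound:
  assumes n: "4 \<le> n"
    and member: "\<And>x y. gadget c n x y \<in> \<G>"
    and solves: "solves_connectivity A p \<G>"
  shows "\<exists>G \<in> \<G>. \<exists>s. al_stream G s \<and> n div 2 - 2 \<le> 4 * bits_used A p s * p"
proof -
  define U where "U = {2..<n div 2}"
  define f where "f x = half_stream c n x {} True" for x
  define g where "g x = half_stream c n {} (U - x) False" for x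
  have stream: "al_stream (gadget c n x (U - x')) (f x @ g x')" for x x'
    using al_stream_gadget[of c n x "U - x'"]
    unfolding f_def g_def half_stream_True[symmetric] half_stream_False[symmetric]
    by (metis half_stream_True half_stream_False)
  have answer: "answer A (after_passes A (f x @ g x') p) \<longleftrightarrow> x \<inter> (U - x') = {}"
    if "x \<in> Pow U" for x x'
    using solves member stream[of x x'] connected_gadget_iff[OF n, of x "U - x'" c] that
    unfolding solves_connectivity_def U_def by auto
  \<comment> \<open>The maximum is attained, so a lower bound on \<open>Max B\<close> is one for a
    concrete stream.\<close>
  define B where "B = (\<lambda>x. bits_used A p (f x @ g x)) ` Pow U"
  have B: "finite B" "B \<noteq> {}"
    by (auto simp: B_def U_def)
  have "card (Pow U) \<le> 4 ^ (2 * Max B * p)"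
  proof (rule fooling_set_bound[where f = f and g = g])
    show "finite (Pow U)" by (simp add: U_def)
    show "bits_used A p (f x @ g x) \<le> Max B" if "x \<in> Pow U" for x
      using B that by (intro Max_ge) (auto simp: B_def)
    show "answer A (after_passes A (f x @ g x) p)" if "x \<in> Pow U" for x
      using answer[OF that] by blast
    show "\<not> answer A (after_passes A (f x @ g x') p) \<or> \<not> answer A (after_passes A (f x' @ g x) p)"
      if "x \<in> Pow U" "x' \<in> Pow U" "x \<noteq> x'" for x x'
      using answer that by blast
  qed
  also have "\<dots> = 2 ^ (4 * Max B * p)"
    using power_mult[of "2::nat" 2 "2 * Max B * p"] by (simp add: mult.assoc)
  finally have "(2::nat) ^ (n div 2 - 2) \<le> 2 ^ (4 * Max B * p)"
    by (simp add: card_Pow U_def)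
  then have "n div 2 - 2 \<le> 4 * Max B * p"
    by simp
  moreover obtain x where "Max B = bits_used A p (f x @ g x)"
    using Max_in[OF B] unfolding B_def by blast
  ultimately show ?thesis
    using member stream[of x x] by metis
qed

section \<open>Forbidden subgraphs of the hard instances\<close>

text \<open>Read a vertex as the pair of its index \<open>u div 2\<close> and its parity. An edge
  changes exactly one coordinate: the parity away from index 0, or the index to or from 0. Short
  cycles are then excluded by cases on coordinates.\<close>

lemma star_gadget_adjD:
  assumes "gadget_adj False x y u v"
  shows "u div 2 = v div 2 \<and> 1 \<le> u div 2 \<and> even u \<noteq> even v \<or>
    u div 2 \<noteq> v div 2 \<and> even u = even v \<and> (u div 2 = 0 \<or> v div 2 = 0)"
  using assms nat_eq_half_parity[of u v] by (auto simp: gadget_adj_def matched_def side_adj_def)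

lemma star_gadget_no_triangle:
  assumes "gadget_adj False x y a b" "gadget_adj False x y b d" "gadget_adj False x y d a"
  shows False
  using assms[THEN star_gadget_adjD] by auto

lemma star_gadget_no_four_cycle:
  assumes "gadget_adj False x y a b" "gadget_adj False x y b d"
    "gadget_adj False x y d e" "gadget_adj False x y e a"
    and "a \<noteq> d" "b \<noteq> e"
  shows False
proof -
  \<comment> \<open>Index and parity determine a vertex, so opposite corners differ in a
    coordinate.\<close>
  have "a div 2 \<noteq> d div 2 \<or> even a \<noteq> even d" "b div 2 \<noteq> e div 2 \<or> even b \<noteq> even e"
    using assms(5,6) nat_eq_half_parity by blast+
  then show False
    using assms(1-4)[THEN star_gadget_adjD] by (smt (verit) not_one_le_zero)
qed

lemma clique_trans:
  "side_adj True x y u v \<Longrightarrow> side_adj True x y u w \<Longrightarrow> v = w \<or> side_adj True x y v w"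
  by (auto simp: side_adj_def)

text \<open>At most one neighbour of \<open>v\<close> is its partner; the other two lie in its
  clique.\<close>

lemma clique_gadget_claw:
  assumes "gadget_adj True x y v w1" "gadget_adj True x y v w2" "gadget_adj True x y v w3"
    and "distinct [w1, w2, w3]"
  shows "gadget_adj True x y w1 w2 \<or> gadget_adj True x y w1 w3 \<or> gadget_adj True x y w2 w3"
  using assms matched_unique[of v] clique_trans[of x y v] unfolding gadget_adj_def distinct.simps
  by (metis list.set_intros(1) list.set_intros(2))

text \<open>
  An induced walk in the clique gadget alternates between matching and clique edges, so five
  consecutive edges of it visit one of the two cliques twice.
\<close>

lemma clique_gadget_alternating:
  assumes "side_adj True x y a b" "matched b d" "side_adj True x y d e" "matched e f"
    "side_adj True x y f g"
  shows "side_adj True x y b f"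
proof -
  have "b \<noteq> f"
    using assms matched_unique[of b d e] matched_sym[of e f] by (auto simp: side_adj_def)
  moreover have "even b = even f"
    using assms matched_parity[of b d] matched_parity[of e f] by (auto simp: side_adj_def)
  \<comment> \<open>Liveness of \<open>b\<close> and \<open>f\<close> is read off the outer clique
    edges, from \<open>a\<close> to \<open>b\<close> and from \<open>f\<close> to
    \<open>g\<close>.\<close>
  ultimately show ?thesis
    using assms by (auto simp: side_adj_def)
qed

text \<open>Two consecutive matching edges would backtrack, and two consecutive clique edges would
  make \<open>f i\<close> and \<open>f (i + 2)\<close> equal or adjacent. So the two kinds
  alternate.\<close>

lemma clique_gadget_walk:
  fixes f :: "nat \<Rightarrow> nat"
  assumes adj: "\<And>i. i < 6 \<Longrightarrow> gadget_adj True x y (f i) (f (Suc i))"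
    and ind: "\<And>i. i < 5 \<Longrightarrow> f i \<noteq> f (i + 2) \<and> \<not> gadget_adj True x y (f i) (f (i + 2))"
  shows "\<exists>i < 3. gadget_adj True x y (f i) (f (i + 3))"
proof -
  have match_side: "side_adj True x y (f (Suc i)) (f (i + 2))" if "matched (f i) (f (Suc i))" "i < 5" for i
    using that adj[of "Suc i"] ind[of i] matched_unique[of "f (Suc i)" "f i" "f (i + 2)"]
      matched_sym unfolding gadget_adj_def by auto
  have side_match: "matched (f (Suc i)) (f (i + 2))" if "side_adj True x y (f i) (f (Suc i))" "i < 5" for i
    using that adj[of "Suc i"] ind[of i] clique_trans[of x y "f (Suc i)" "f i" "f (i + 2)"]
      side_adj_sym unfolding gadget_adj_def by auto
  have main: "gadget_adj True x y (f (i + 1)) (f (i + 4))"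
    if "side_adj True x y (f i) (f (Suc i))" "i < 2" for i
  proof -
    have 1: "matched (f (i + 1)) (f (i + 2))"
      using side_match[of i] that by simp
    have 2: "side_adj True x y (f (i + 2)) (f (i + 3))"
      using match_side[of "i + 1"] 1 that by (simp add: numeral_eq_Suc)
    have 3: "matched (f (i + 3)) (f (i + 4))"
      using side_match[of "i + 2"] 2 that by (simp add: numeral_eq_Suc)
    have 4: "side_adj True x y (f (i + 4)) (f (i + 5))"
      using match_side[of "i + 3"] 3 that by (simp add: numeral_eq_Suc)
    show ?thesis
      using clique_gadget_alternating[OF _ 1 2 3 4, of "f i"] that by (simp add: gadget_adj_def)
  qed
  show ?thesis
  \<comment> \<open>The five-edge pattern must begin with a clique edge, hence at position 0 or 1,
    which takes six edges in all. The chord then starts at 1 or 2.\<close>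
  proof (cases "side_adj True x y (f 0) (f (Suc 0))")
    case True
    then show ?thesis using main[of 0] by (intro exI[of _ 1]) simp
  next
    case False
    then have "matched (f 0) (f (Suc 0))"
      using adj[of 0] by (simp add: gadget_adj_def)
    then have "side_adj True x y (f 1) (f (Suc 1))"
      using match_side[of 0] by (simp add: numeral_eq_Suc)
    then show ?thesis using main[of 1] by (intro exI[of _ 2]) (simp add: numeral_2_eq_2)
  qed
qed

text \<open>A digraph isomorphism carries separate maps for vertices, arcs and ends; the arguments
  below work with the vertex map alone.\<close>

lemma not_free_ofE:
  assumes "\<not> free_of H G"
  obtains f where "inj_on f (pverts H)" "f ` pverts H \<subseteq> pverts G"
    "\<And>u v. u \<in> pverts H \<Longrightarrow> v \<in> pverts H \<Longrightarrow> (u, v) \<in> parcs H \<longleftrightarrow> (f u, f v) \<in> parcs G"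
proof -
  obtain F h where F: "induced_subgraph F (with_proj G)"
    and h: "pre_digraph.digraph_isomorphism (with_proj H) h" and eq: "F = app_iso h (with_proj H)"
    using assms unfolding free_of_def digraph_iso_def by blast
  let ?f = "iso_verts h"
  have inj: "inj_on ?f (pverts H)"
    using h by (simp add: pre_digraph.digraph_isomorphism_def)
  have verts: "verts F = ?f ` pverts H"
    by (simp add: eq)
  \<comment> \<open>A subgraph of \<open>with_proj G\<close> has end maps \<open>fst\<close> and
    \<open>snd\<close>, and those of \<open>app_iso\<close> come from \<open>h\<close>. This
    determines the arc map from the vertex map.\<close>
  have ends: "iso_tail h = fst" "iso_head h = snd"
    using F unfolding induced_subgraph_def subgraph_def compatible_def eq by simp_all
  have arc: "iso_arcs h (u, v) = (?f u, ?f v)" if "(u, v) \<in> parcs H" for u v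
    using h that unfolding pre_digraph.digraph_isomorphism_def ends
    by (metis fst_conv snd_conv prod.collapse with_proj_simps(2,4,5))
  have arcs: "iso_arcs h ` parcs H = {e \<in> parcs G. fst e \<in> verts F \<and> snd e \<in> verts F}"
    using F unfolding induced_subgraph_def subgraph_def compatible_def eq by (auto simp: ends)
  have wf: "wf_digraph (with_proj H)"
    using h by (simp add: pre_digraph.digraph_isomorphism_def)
  show thesis
  proof
    show "?f ` pverts H \<subseteq> pverts G"
      using F verts by (auto simp: induced_subgraph_def subgraph_def)
    fix u v
    assume uv: "u \<in> pverts H" "v \<in> pverts H"
    show "(u, v) \<in> parcs H \<longleftrightarrow> (?f u, ?f v) \<in> parcs G"
    proof
      assume "(u, v) \<in> parcs H"
      then show "(?f u, ?f v) \<in> parcs G"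
        using arc arcs by force
    next
      assume "(?f u, ?f v) \<in> parcs G"
      \<comment> \<open>\<open>F\<close> is induced, so this pair is an arc of \<open>F\<close> and
        has a preimage in \<open>H\<close>, which injectivity identifies with
        \<open>(u, v)\<close>.\<close>
      then have "(?f u, ?f v) \<in> iso_arcs h ` parcs H"
        using arcs verts uv by auto
      then obtain u' v' where e: "(u', v') \<in> parcs H" "iso_arcs h (u', v') = (?f u, ?f v)"
        by (metis imageE surj_pair)
      then have "u' \<in> pverts H" "v' \<in> pverts H"
        using wf by (auto simp: wf_digraph_wp_iff dest: pair_wf_digraph.wellformed')
      moreover have "?f u' = ?f u" "?f v' = ?f v"
        using e arc by auto
      ultimately have "u' = u" "v' = v"
        using inj uv by (auto dest: inj_onD)
      then show "(u, v) \<in> parcs H"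
        using e by simp
    qed
  qed (rule inj)
qed

section \<open>Graphs without long non-backtracking walks\<close>

text \<open>As a list, the path comes with the map \<open>nth xs\<close> from positions to vertices,
  which later serves as the isomorphism from \<open>path_graph\<close>.\<close>

definition induced_path :: "('a \<times> 'a) set \<Rightarrow> 'a list \<Rightarrow> bool" where
  "induced_path E xs \<longleftrightarrow> distinct xs \<and>
    (\<forall>i < length xs. \<forall>j < length xs. (xs ! i, xs ! j) \<in> E \<longleftrightarrow> j = Suc i \<or> i = Suc j)"

lemma induced_pathD:
  assumes "induced_path E xs"
  shows "distinct xs"
    and "i < length xs \<Longrightarrow> j < length xs \<Longrightarrow> (xs ! i, xs ! j) \<in> E \<longleftrightarrow> j = Suc i \<or> i = Suc j"
  using assms by (auto simp: induced_path_def)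

lemma induced_path_rev: "induced_path E xs \<Longrightarrow> induced_path E (rev xs)"
  unfolding induced_path_def by (auto simp: rev_nth)

text \<open>These are the properties that embeddings into both gadgets force on \<open>H\<close>.
  The walk \<open>f\<close> may revisit vertices, so \<open>no_walk\<close> also excludes short
  cycles, round which one can go repeatedly.\<close>

locale short_walks =
  fixes E :: "('a \<times> 'a) set"
  assumes sym: "(u, v) \<in> E \<Longrightarrow> (v, u) \<in> E"
    and irrefl: "(v, v) \<notin> E"
    and degree: "(v, w1) \<in> E \<Longrightarrow> (v, w2) \<in> E \<Longrightarrow> (v, w3) \<in> E \<Longrightarrow> \<not> distinct [w1, w2, w3]"
    and no_walk: "(\<And>i. i < 6 \<Longrightarrow> (f i, f (Suc i)) \<in> E) \<Longrightarrow> \<exists>i < 5. f i = f (i + 2 :: nat)"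
begin

lemma induced_path_length:
  assumes "induced_path E xs"
  shows "length xs \<le> 6"
proof (rule ccontr)
  assume "\<not> length xs \<le> 6"
  then have "\<exists>i < 5. xs ! i = xs ! (i + 2)"
    using induced_pathD(2)[OF assms] by (intro no_walk) auto
  then show False
    using induced_pathD(1)[OF assms] \<open>\<not> length xs \<le> 6\<close> by (auto simp: nth_eq_iff_index_eq)
qed

text \<open>Such a \<open>w\<close> would close \<open>xs\<close> to a cycle of length
  \<open>k\<close>, at least 3. Going round it with indices modulo \<open>k\<close> never
  backtracks, since \<open>k\<close> does not divide 2.\<close>

lemma induced_path_no_cycle:
  assumes xs: "induced_path E xs" and w: "w \<notin> set xs" and len: "2 \<le> length xs"
    and ends: "(xs ! 0, w) \<in> E" "(xs ! (length xs - 1), w) \<in> E"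
  shows False
proof -
  define zs where "zs = w # xs"
  define k where "k = length zs"
  have k: "3 \<le> k" and dist: "distinct zs"
    using len w induced_pathD(1)[OF xs] by (auto simp: k_def zs_def)
  have step: "(zs ! i, zs ! (Suc i mod k)) \<in> E" if "i < k" for i
  proof (cases "Suc i = k")
    case True
    then show ?thesis
      using ends len by (auto simp: k_def zs_def nth_Cons')
  next
    case False
    then have "Suc i < k" using that by simp
    then show ?thesis
      using ends sym induced_pathD(2)[OF xs] by (cases i) (auto simp: k_def zs_def)
  qed
  have "(zs ! (i mod k), zs ! (Suc i mod k)) \<in> E" for i
    using step[of "i mod k"] k by (simp add: mod_Suc_eq)
  then obtain i where i: "zs ! (i mod k) = zs ! ((i + 2) mod k)"
    using no_walk[of "\<lambda>i. zs ! (i mod k)"] by auto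
  then have "i mod k = (i + 2) mod k"
    using nth_eq_iff_index_eq[OF dist, of "i mod k" "(i + 2) mod k"] k unfolding k_def
    by (metis mod_less_divisor zero_less_numeral less_le_trans)
  then have "k dvd 2"
    by (metis mod_eq_dvd_iff_nat add_diff_cancel_left' le_add1)
  then show False
    using k by (auto dest: dvd_imp_le)
qed

text \<open>There are no further edges from \<open>w\<close> to the path: inner vertices already
  have two neighbours, and an edge to the far end would close a cycle.\<close>

lemma induced_path_Cons:
  assumes xs: "induced_path E xs" and w: "w \<notin> set xs" and "xs \<noteq> []" and "(xs ! 0, w) \<in> E"
  shows "induced_path E (w # xs)"
proof -
  have inner: "(xs ! i, w) \<notin> E" if i: "0 < i" "i < length xs" for i
  proof
    assume adj: "(xs ! i, w) \<in> E"
    show False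
    proof (cases "Suc i = length xs")
      case True
      then show False
        using induced_path_no_cycle[OF xs w] assms(4) adj i
        by (metis Suc_leI diff_Suc_1 numeral_2_eq_2 less_Suc_eq_le)
    next
      case False
      then have "(xs ! i, xs ! (i - 1)) \<in> E" "(xs ! i, xs ! Suc i) \<in> E"
        using induced_pathD(2)[OF xs] i by auto
      moreover have "distinct [xs ! (i - 1), xs ! Suc i, w]"
        using False i w induced_pathD(1)[OF xs] by (auto simp: nth_eq_iff_index_eq)
      ultimately show False
        using degree adj by blast
    qed
  qed
  have w_adj: "(w, xs ! j) \<in> E \<longleftrightarrow> j = 0" "(xs ! j, w) \<in> E \<longleftrightarrow> j = 0" if "j < length xs" for j
    using inner[of j] that assms(4) sym by (cases j; blast)+
  show ?thesis
    unfolding induced_path_def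
    using w_adj irrefl w induced_pathD[OF xs] by (auto simp: nth_Cons split: nat.splits)
qed

text \<open>By the degree bound \<open>u\<close> is an end of the path; reversal reduces the last
  position to the first.\<close>

lemma induced_path_extend:
  assumes xs: "induced_path E xs" and w: "w \<notin> set xs" and u: "u \<in> set xs" "(u, w) \<in> E"
  shows "\<exists>ys. induced_path E ys \<and> set ys = insert w (set xs)"
proof -
  obtain i where i: "i < length xs" "u = xs ! i"
    using u by (auto simp: in_set_conv_nth)
  consider "i = 0" | "Suc i = length xs" | "0 < i" "Suc i < length xs"
    using i by linarith
  then show ?thesis
  proof cases
    case 1
    then show ?thesis
      using induced_path_Cons[OF xs w] u i by (intro exI[of _ "w # xs"]) auto
  next
    case 2
    then have "rev xs ! 0 = u"
      using i by (simp add: rev_nth flip: 2)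
    moreover have "rev xs \<noteq> []"
      using i by auto
    ultimately show ?thesis
      using induced_path_Cons[OF induced_path_rev[OF xs], of w] w u i
      by (intro exI[of _ "w # rev xs"]) auto
  next
    case 3
    then have "(u, xs ! (i - 1)) \<in> E" "(u, xs ! Suc i) \<in> E"
      using induced_pathD(2)[OF xs] i by auto
    moreover have "distinct [xs ! (i - 1), xs ! Suc i, w]"
      using 3 i w induced_pathD(1)[OF xs] by (auto simp: nth_eq_iff_index_eq)
    ultimately show ?thesis
      using degree u by blast
  qed
qed

text \<open>Here \<open>grow\<close> expresses connectivity of \<open>V\<close>. A longest induced
  path through \<open>v\<close> within \<open>V\<close> exists because lengths are bounded, and an
  edge leaving it would extend it.\<close>

lemma ex_spanning_induced_path:
  assumes v: "v \<in> V"
    and grow: "\<And>S. v \<in> S \<Longrightarrow> S \<subset> V \<Longrightarrow> \<exists>u \<in> S. \<exists>w \<in> V - S. (u, w) \<in> E"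
  shows "\<exists>xs. induced_path E xs \<and> set xs = V"
proof -
  define P where "P xs \<longleftrightarrow> induced_path E xs \<and> v \<in> set xs \<and> set xs \<subseteq> V" for xs
  have "P [v]"
    using v irrefl by (simp add: P_def induced_path_def)
  moreover have "\<forall>xs. P xs \<longrightarrow> length xs < 7"
    using induced_path_length by (auto simp: P_def le_imp_less_Suc numeral_eq_Suc)
  ultimately obtain xs where xs: "P xs" and max: "\<And>ys. P ys \<Longrightarrow> length ys \<le> length xs"
    using ex_has_greatest_nat[of P "[v]" length 7] by blast
  have "set xs = V"
  proof (rule ccontr)
    assume "set xs \<noteq> V"
    then obtain u w where uw: "u \<in> set xs" "w \<in> V - set xs" "(u, w) \<in> E"
      using grow[of "set xs"] xs unfolding P_def by blast
    then obtain ys where ys: "induced_path E ys" "set ys = insert w (set xs)"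
      using induced_path_extend[of xs w u] xs unfolding P_def by auto
    then have "P ys"
      using xs uw by (auto simp: P_def)
    moreover have "length ys = Suc (length xs)"
      using ys uw xs distinct_card[of ys] distinct_card[of xs]
      by (auto simp: P_def dest!: induced_pathD(1))
    ultimately show False
      using max by fastforce
  qed
  with xs show ?thesis
    by (auto simp: P_def)
qed

end

section \<open>From spanning induced paths to components\<close>

lemma strongly_connected_cut:
  assumes "strongly_connected C" and "v \<in> S" "S \<subset> verts C"
  shows "\<exists>u \<in> S. \<exists>w \<in> verts C - S. (u, w) \<in> arcs_ends C"
proof (rule ccontr)
  \<comment> \<open>If no arc left \<open>S\<close>, everything reachable from \<open>v\<close>
    would stay in \<open>S\<close>.\<close>
  assume closed: "\<not> ?thesis"
  obtain z where z: "z \<in> verts C" "z \<notin> S"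
    using assms by auto
  have "v \<rightarrow>\<^sup>*\<^bsub>C\<^esub> z"
    using assms z by (auto simp: strongly_connected_def)
  then have "(v, z) \<in> rtrancl_on (verts C) (arcs_ends C)"
    by (simp add: reachable_def)
  then have "z \<in> S"
    by (induction rule: rtrancl_on_induct) (use assms closed in auto)
  with z show False by simp
qed

lemma digraph_iso_path_graph:
  assumes C: "induced_subgraph C (with_proj H)"
    and xs: "induced_path (parcs H) xs" "set xs = verts C" "length xs = Suc l"
  shows "digraph_iso C (with_proj (path_graph l))"
proof -
  \<comment> \<open>The map goes from the path to \<open>C\<close>, sending position
    \<open>i\<close> to \<open>xs ! i\<close>; \<open>digraph_iso_swap\<close> turns it round at the
    end.\<close>
  define h where "h = \<lparr> iso_verts = nth xs, iso_arcs = map_prod (nth xs) (nth xs),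
    iso_head = snd, iso_tail = fst \<rparr>"
  have inj: "inj_on (nth xs) {0..l}"
    using induced_pathD(1)[OF xs(1)] xs(3) by (auto simp: inj_on_def nth_eq_iff_index_eq)
  have wf: "wf_digraph (with_proj (path_graph l))"
    unfolding wf_digraph_wp_iff by unfold_locales (auto simp: path_graph_def)
  have "inj_on (map_prod (nth xs) (nth xs)) (parcs (path_graph l))"
    by (rule inj_on_subset[OF map_prod_inj_on[OF inj inj]]) (auto simp: path_graph_def)
  then have iso: "pre_digraph.digraph_isomorphism (with_proj (path_graph l)) h"
    using inj wf by (auto simp: pre_digraph.digraph_isomorphism_def h_def path_graph_def)
  have verts: "nth xs ` {0..l} = verts C"
    unfolding xs(2)[symmetric] using xs(3) by (auto simp: set_conv_nth less_Suc_eq_le)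
  have ends: "tail C = fst" "head C = snd"
    using C by (auto simp: induced_subgraph_def subgraph_def compatible_def)
  have "arcs C = {e \<in> parcs H. fst e \<in> verts C \<and> snd e \<in> verts C}"
    using C ends by (auto simp: induced_subgraph_def)
  also have "\<dots> = map_prod (nth xs) (nth xs) ` parcs (path_graph l)"
  proof (intro equalityI subsetI)
    fix e
    assume "e \<in> {e \<in> parcs H. fst e \<in> verts C \<and> snd e \<in> verts C}"
    then have e: "e \<in> parcs H" "fst e \<in> nth xs ` {0..l}" "snd e \<in> nth xs ` {0..l}"
      unfolding verts by auto
    then obtain i j where ij: "i \<le> l" "j \<le> l" "e = (xs ! i, xs ! j)"
      by (metis (no_types, lifting) atLeastAtMost_iff imageE prod.collapse)
    then have "(i, j) \<in> parcs (path_graph l)"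
      using induced_pathD(2)[OF xs(1), of i j] xs(3) e by (simp add: path_graph_def)
    then show "e \<in> map_prod (nth xs) (nth xs) ` parcs (path_graph l)"
      using ij by (auto intro!: image_eqI[of _ _ "(i, j)"])
  next
    fix e
    assume "e \<in> map_prod (nth xs) (nth xs) ` parcs (path_graph l)"
    then obtain i j where ij: "i \<le> l" "j \<le> l" "j = Suc i \<or> i = Suc j" "e = (xs ! i, xs ! j)"
      by (auto simp: path_graph_def)
    then show "e \<in> {e \<in> parcs H. fst e \<in> verts C \<and> snd e \<in> verts C}"
      using induced_pathD(2)[OF xs(1), of i j] nth_mem[of i xs] nth_mem[of j xs] xs(2,3)
      by (simp add: less_Suc_eq_le)
  qed
  finally have "C = app_iso h (with_proj (path_graph l))"
    using verts ends by (intro pre_digraph.equality) (auto simp: h_def path_graph_def)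
  with iso have "digraph_iso (with_proj (path_graph l)) C"
    unfolding digraph_iso_def by blast
  then show ?thesis
    using wf by (rule digraph_iso_swap[rotated])
qed

lemma (in short_walks) component_iso_path_graph:
  assumes E: "E = parcs H" and C: "C \<in> components H"
  shows "\<exists>l \<le> 5. digraph_iso C (with_proj (path_graph l))"
proof -
  have ind: "induced_subgraph C (with_proj H)" and sc: "strongly_connected C"
    using C by (auto simp: pre_digraph.sccs_def)
  obtain v where v: "v \<in> verts C"
    using sc by (auto simp: strongly_connected_def)
  have "arcs_ends C \<subseteq> E"
    using arcs_ends_mono[OF induced_imp_subgraph[OF ind]] E by simp
  then have "\<exists>u \<in> S. \<exists>w \<in> verts C - S. (u, w) \<in> E" if "v \<in> S" "S \<subset> verts C" for S
    using strongly_connected_cut[OF sc that] by blast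
  then obtain xs where xs: "induced_path E xs" "set xs = verts C"
    using ex_spanning_induced_path[OF v] by metis
  then have "xs \<noteq> []"
    using v by auto
  then obtain l where l: "length xs = Suc l"
    by (metis length_0_conv not0_implies_Suc)
  \<comment> \<open>At most six vertices means at most five edges.\<close>
  show ?thesis
    using digraph_iso_path_graph[OF ind _ xs(2) l] xs(1) E induced_path_length[OF xs(1)] l
    by auto
qed

section \<open>Choice of the gadget family and the final bound\<close>

lemma gadget_free_of:
  assumes H: "pair_graph H"
    and not_short: "\<not> (linear_forest H \<and>
      (\<forall>C \<in> components H. \<exists>l \<le> 5. digraph_iso C (with_proj (path_graph l))))"
  shows "\<exists>c. \<forall>n x y. free_of H (gadget c n x y)"
proof (rule ccontr)
  \<comment> \<open>One flag has to serve all \<open>n\<close>, \<open>x\<close> and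
    \<open>y\<close>. If neither does, \<open>H\<close> embeds in a star gadget and in a clique
    gadget, possibly with different parameters. The first embedding excludes triangles and 4-cycles
    from \<open>H\<close>; the second then yields \<open>short_walks\<close>.\<close>
  assume contr: "\<not> ?thesis"
  interpret H: pair_graph H by (rule H)
  obtain n x y where "\<not> free_of H (gadget False n x y)"
    using contr by blast
  then obtain f where inj: "inj_on f (pverts H)" and
    f: "\<And>u v. u \<in> pverts H \<Longrightarrow> v \<in> pverts H \<Longrightarrow>
      (u, v) \<in> parcs H \<longleftrightarrow> (f u, f v) \<in> parcs (gadget False n x y)"
    by (rule not_free_ofE) blast
  have f_adj: "gadget_adj False x y (f u) (f v)" if "(u, v) \<in> parcs H" for u v
    using f[of u v] that H.wellformed'[OF that] by (simp add: parcs_gadget)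
  have no_triangle: False if "(a, b) \<in> parcs H" "(b, d) \<in> parcs H" "(d, a) \<in> parcs H" for a b d
    using star_gadget_no_triangle f_adj that by blast
  have no_four_cycle: False
    if "(a, b) \<in> parcs H" "(b, d) \<in> parcs H" "(d, e) \<in> parcs H" "(e, a) \<in> parcs H" "a \<noteq> d" "b \<noteq> e"
    for a b d e
  proof -
    have "f a \<noteq> f d" "f b \<noteq> f e"
      using that inj H.wellformed' by (auto dest!: inj_onD[OF inj])
    then show False
      using star_gadget_no_four_cycle[of x y "f a" "f b" "f d" "f e"] f_adj that by blast
  qed
  obtain n' x' y' where "\<not> free_of H (gadget True n' x' y')"
    using contr by blast
  then obtain g where inj': "inj_on g (pverts H)" and
    "g ` pverts H \<subseteq> pverts (gadget True n' x' y')" and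
    "\<And>u v. u \<in> pverts H \<Longrightarrow> v \<in> pverts H \<Longrightarrow>
      (u, v) \<in> parcs H \<longleftrightarrow> (g u, g v) \<in> parcs (gadget True n' x' y')"
    by (rule not_free_ofE) blast
  then have g: "(u, v) \<in> parcs H \<longleftrightarrow> gadget_adj True x' y' (g u) (g v)"
    if "u \<in> pverts H" "v \<in> pverts H" for u v
    using that by (auto simp: parcs_gadget)
  have "short_walks (parcs H)"
  proof
    show "(v, u) \<in> parcs H" if "(u, v) \<in> parcs H" for u v
      using that by (rule H.arcs_symmetric)
    show "(v, v) \<notin> parcs H" for v
      using H.no_loops' by blast
    show "\<not> distinct [w1, w2, w3]"
      if w: "(v, w1) \<in> parcs H" "(v, w2) \<in> parcs H" "(v, w3) \<in> parcs H" for v w1 w2 w3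
    proof
      assume dist: "distinct [w1, w2, w3]"
      have V: "v \<in> pverts H" "w1 \<in> pverts H" "w2 \<in> pverts H" "w3 \<in> pverts H"
        using w H.wellformed' by blast+
      then have "distinct [g w1, g w2, g w3]"
        using dist inj' by (auto dest: inj_onD)
      then have "(w1, w2) \<in> parcs H \<or> (w1, w3) \<in> parcs H \<or> (w2, w3) \<in> parcs H"
        using clique_gadget_claw[of x' y' "g v" "g w1" "g w2" "g w3"] g V w by blast
      then show False
        using w no_triangle H.arcs_symmetric by blast
    qed
    show "\<exists>i < 5. h i = h (i + 2)"
      if walk: "\<And>i. i < 6 \<Longrightarrow> (h i, h (Suc i)) \<in> parcs H" for h :: "nat \<Rightarrow> _"
    proof (rule ccontr)
      assume "\<not> ?thesis"
      then have nb: "h i \<noteq> h (i + 2)" if "i < 5" for i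
        using that by blast
      have V: "h i \<in> pverts H" if "i \<le> 6" for i
      proof (cases "i = 6")
        case True
        then show ?thesis using H.in_arcsD2[OF walk[of 5]] by simp
      next
        case False
        then show ?thesis using H.in_arcsD1[OF walk[of i]] that by simp
      qed
      have "\<exists>i < 3. gadget_adj True x' y' (g (h i)) (g (h (i + 3)))"
      proof (rule clique_gadget_walk[where f = "\<lambda>i. g (h i)"])
        show "gadget_adj True x' y' (g (h i)) (g (h (Suc i)))" if "i < 6" for i
          using walk[OF that] g[OF V V, of i "Suc i"] that by simp
        show "g (h i) \<noteq> g (h (i + 2)) \<and> \<not> gadget_adj True x' y' (g (h i)) (g (h (i + 2)))"
          if i: "i < 5" for i
        proof
          show "g (h i) \<noteq> g (h (i + 2))"
            using nb[OF i] V[of i] V[of "i + 2"] i inj' by (auto dest: inj_onD)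
          \<comment> \<open>A chord over two steps would close a triangle, so the image walk meets
            the hypothesis of \<open>clique_gadget_walk\<close>.\<close>
          have "(h (i + 2), h i) \<notin> parcs H"
            using no_triangle[of "h i" "h (Suc i)" "h (i + 2)"] walk[of i] walk[of "Suc i"] i by auto
          then show "\<not> gadget_adj True x' y' (g (h i)) (g (h (i + 2)))"
            using g[of "h i" "h (i + 2)"] V[of i] V[of "i + 2"] i H.arcs_symmetric by auto
        qed
      qed
      then obtain i where i: "i < 3" "gadget_adj True x' y' (g (h i)) (g (h (i + 3)))"
        by blast
      then have "(h i, h (i + 3)) \<in> parcs H"
        using g V by simp
      \<comment> \<open>The chord over three steps closes a 4-cycle, whose opposite vertices differ
        because the walk does not backtrack.\<close>
      then show False
        using no_four_cycle[of "h i" "h (Suc i)" "h (i + 2)" "h (i + 3)"] H.arcs_symmetric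
          walk[of i] walk[of "Suc i"] walk[of "i + 2"] nb[of i] nb[of "Suc i"] i
        by (auto simp: numeral_eq_Suc)
    qed
  qed
  then have "\<forall>C \<in> components H. \<exists>l \<le> 5. digraph_iso C (with_proj (path_graph l))"
    using short_walks.component_iso_path_graph by blast
  with not_short show False
    unfolding linear_forest_def by blast
qed

theorem theorem5:
  fixes H :: "'h pair_pre_digraph"
  assumes "pair_graph H"
    and "\<not> (linear_forest H \<and>
            (\<forall>C \<in> components H. \<exists>l \<le> 5. digraph_iso C (with_proj (path_graph l))))"
  shows "\<exists>c > (0::real). \<exists>n0. \<forall>n \<ge> n0. \<forall>p \<ge> 1. \<forall>A.
           solves_connectivity A p (free_graphs H n) \<longrightarrow>
           (\<exists>G \<in> free_graphs H n. \<exists>s. al_stream G s \<and>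
              real (bits_used A p s) \<ge> c * (real n / real p))"
proof -
  obtain c where c: "\<And>n x y. free_of H (gadget c n x y)"
    using gadget_free_of[OF assms] by blast
  have "\<exists>G \<in> free_graphs H n. \<exists>s. al_stream G s \<and>
      real (bits_used A p s) \<ge> 1 / 16 * (real n / real p)"
    if n: "10 \<le> n" and p: "1 \<le> p" and A: "solves_connectivity A p (free_graphs H n)" for n p A
  proof -
    have "gadget c n x y \<in> free_graphs H n" for x y
      using c pair_graph_gadget by (simp add: free_graphs_def)
    then obtain G s where G: "G \<in> free_graphs H n" "al_stream G s"
      and bits: "n div 2 - 2 \<le> 4 * bits_used A p s * p"
      using gadget_lower_bound[where c = c and n = n, OF _ _ A] n by auto
    \<comment> \<open>This fails at \<open>n = 9\<close>, hence the threshold 10. Together with the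
      factor 4 in \<open>bits\<close> it gives the constant \<open>1 / 16\<close>.\<close>
    have "n \<le> 4 * (n div 2 - 2)"
      using n by linarith
    with bits have "n \<le> 16 * (bits_used A p s * p)"
      by linarith
    then have "real n \<le> 16 * (real (bits_used A p s) * real p)"
      by (metis of_nat_le_iff of_nat_mult of_nat_numeral)
    then have "real (bits_used A p s) \<ge> 1 / 16 * (real n / real p)"
      using p by (simp add: field_simps)
    with G show ?thesis by blast
  qed
  then show ?thesis
    by (intro exI[of _ "1 / 16"] conjI exI[of _ 10]) auto
qed

end
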